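(* Let $n\geq 2$ and let $F:\mathbb{R}^n\to\mathbb{R}^n$ be a $C^1$ map. Suppose that $0\notin \mathrm{Spec}(F)$ and that for some $\varepsilon>0$ either $\mathrm{Spec}(F+F^T)\subseteq(-\infty,-\varepsilon)$ or $\mathrm{Spec}(F+F^T)\subseteq(\varepsilon,+\infty)$. Then $F$ is injective.
   Context: For a $C^1$ map $F:\mathbb{R}^n\to\mathbb{R}^n$ with Jacobian matrix $JF(x)$ at $x$, $\mathrm{Spec}(F)$ denotes the set of all (complex) eigenvalues of the matrices $JF(x)$, as $x$ ranges over all of $\mathbb{R}^n$, and $\mathrm{Spec}(F+F^T)$ denotes the set of all eigenvalues of the symmetric matrices $JF(x)+JF(x)^T$, as $x$ ranges over all of $\mathbb{R}^n$. *)

theory Defs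
  imports "HOL-Analysis.Analysis"
begin

definition C1_map :: "(real ^ 'n \<Rightarrow> real ^ 'n) \<Rightarrow> bool" where
  "C1_map F \<longleftrightarrow> (\<forall>x. F differentiable (at x)) \<and> continuous_on UNIV (\<lambda>x. jacobian F (at x))"

text \<open>The eigenvalues of a real matrix are taken over the complex numbers: eigenvectors range
  over complex vectors.\<close>

definition eigenvalues :: "real ^ 'n ^ 'n \<Rightarrow> complex set" where
  "eigenvalues A = {l. \<exists>v. v \<noteq> 0 \<and> map_matrix complex_of_real A *v v = l *s v}"

definition Spec :: "(real ^ 'n \<Rightarrow> real ^ 'n) \<Rightarrow> complex set" where
  "Spec F = (\<Union>x. eigenvalues (jacobian F (at x)))"

text \<open>The set written $\mathrm{Spec}(F + F^T)$, where the transpose is that of the Jacobian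
  matrix. It is also typed as a complex set, although its members are real.\<close>

definition Spec_sym :: "(real ^ 'n \<Rightarrow> real ^ 'n) \<Rightarrow> complex set" where
  "Spec_sym F = (\<Union>x. eigenvalues (jacobian F (at x) + transpose (jacobian F (at x))))"

end

(* A C1 map whose Jacobian has definite symmetric part is strictly monotone up to sign: the
   mean value theorem along the segment from a to b gives
   (F b - F a) . (b - a) = (b - a) . JF(z) (b - a), which is half the quadratic form of
   JF(z) + JF(z)^T. That form is definite because a minimiser of the Rayleigh quotient of a
   symmetric matrix is an eigenvector. *)

theory Submission
  imports Defs
begin

text \<open>Since \<open>eigenvalues\<close> asks for a complex eigenvector, a real one is embedded
  entrywise. This lets the real variational argument below produce members of
  \<open>eigenvalues\<close>.\<close>

lemma of_real_in_eigenvaluesI: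
  fixes A :: "real ^ 'n ^ 'n"
  assumes "v \<noteq> 0" and "A *v v = m *s v"
  shows "complex_of_real m \<in> eigenvalues A"
proof -
  let ?v = "(\<chi> i. complex_of_real (v $ i)) :: complex ^ 'n"
  have "?v \<noteq> 0"
    using assms(1) by (auto simp: vec_eq_iff)
  moreover have "map_matrix complex_of_real A *v ?v = complex_of_real m *s ?v"
  proof -
    have "(\<Sum>j\<in>UNIV. A $ i $ j * v $ j) = m * v $ i" for i
      using assms(2) by (simp add: vec_eq_iff matrix_vector_mult_def)
    then have "(\<Sum>j\<in>UNIV. complex_of_real (A $ i $ j) * complex_of_real (v $ j))
        = complex_of_real m * complex_of_real (v $ i)" for i
      by (simp flip: of_real_mult of_real_sum)
    then show ?thesis
      by (simp add: vec_eq_iff matrix_vector_mult_def map_matrix_def)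
  qed
  ultimately show ?thesis
    unfolding eigenvalues_def by blast
qed

lemma inner_transpose_matrix_vector:
  fixes A :: "real ^ 'n ^ 'm"
  shows "x \<bullet> (transpose A *v y) = y \<bullet> (A *v x)"
  by (metis dot_lmul_matrix inner_commute transpose_matrix_vector)

text \<open>A null vector minimises a nonnegative form, so the gradient 2 \<open>S *v v\<close> of
  the form must vanish there. Concretely, if \<open>w = S *v v\<close> were nonzero, a short step
  from \<open>v\<close> in the direction \<open>- w\<close> would make the form negative.\<close>

lemma quadratic_form_null_vector:
  fixes S :: "real ^ 'n ^ 'n"
  assumes sym: "transpose S = S" and nonneg: "\<And>w. 0 \<le> w \<bullet> (S *v w)"
    and null: "v \<bullet> (S *v v) = 0"
  shows "S *v v = 0"
proof (rule ccontr)
  define w where "w = S *v v"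
  assume "S *v v \<noteq> 0"
  then have pos: "w \<bullet> w > 0"
    by (simp add: w_def)
  define q where "q = w \<bullet> (S *v w)"
  have "q \<ge> 0"
    using nonneg by (simp add: q_def)
  \<comment> \<open>The step length must satisfy \<open>t * q < 2 * (w \<bullet> w)\<close>, so that
    the linear decrease outweighs the quadratic term. The summand 1 keeps the denominator positive
    when \<open>q = 0\<close>.\<close>
  define t where "t = (w \<bullet> w) / (q + 1)"
  have "t > 0" "t * (q + 1) = w \<bullet> w"
    using pos \<open>q \<ge> 0\<close> by (auto simp: t_def)
  have cross: "v \<bullet> (S *v w) = w \<bullet> w"
    using inner_transpose_matrix_vector[of v S w] sym by (simp add: w_def)
  have "(v - t *\<^sub>R w) \<bullet> (S *v (v - t *\<^sub>R w)) = t * (t * q - 2 * (w \<bullet> w))"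
    using null cross
    by (simp add: matrix_vector_mult_diff_distrib matrix_vector_mult_scaleR q_def
        inner_diff_left inner_diff_right algebra_simps flip: w_def)
  also have "\<dots> < 0"
  proof (rule mult_pos_neg[OF \<open>t > 0\<close>])
    have "t * q = w \<bullet> w - t"
      using \<open>t * (q + 1) = w \<bullet> w\<close> by (simp add: algebra_simps)
    then show "t * q - 2 * (w \<bullet> w) < 0"
      using pos \<open>t > 0\<close> by linarith
  qed
  finally show False
    using nonneg[of "v - t *\<^sub>R w"] by linarith
qed

text \<open>Take \<open>m\<close> to be the minimum of the form on the unit sphere, attained at some
  \<open>v\<close> by compactness. Then \<open>S - mat m\<close> has a nonnegative form that
  vanishes at \<open>v\<close>, so \<open>v\<close> lies in its kernel and is an eigenvector of
  \<open>S\<close> for \<open>m\<close>.\<close>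

lemma symmetric_matrix_least_eigenvalue:
  fixes S :: "real ^ 'n ^ 'n"
  assumes sym: "transpose S = S"
  obtains m where "complex_of_real m \<in> eigenvalues S" "\<And>x. m * (x \<bullet> x) \<le> x \<bullet> (S *v x)"
proof -
  have "sphere (0 :: real ^ 'n) 1 \<noteq> {}"
    using vector_choose_size[of 1] by auto
  moreover have "continuous_on (sphere 0 1) (\<lambda>x. x \<bullet> (S *v x))"
    by (intro continuous_intros linear_continuous_on matrix_vector_mul_bounded_linear)
  ultimately obtain v where v: "v \<in> sphere 0 1"
    and min: "\<And>y. y \<in> sphere 0 1 \<Longrightarrow> v \<bullet> (S *v v) \<le> y \<bullet> (S *v y)"
    using continuous_attains_inf[of "sphere 0 1" "\<lambda>x. x \<bullet> (S *v x)"] by auto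
  define m where "m = v \<bullet> (S *v v)"
  have le: "m * (x \<bullet> x) \<le> x \<bullet> (S *v x)" for x
  proof (cases "x = 0")
    case False
    \<comment> \<open>The form is homogeneous of degree 2, so the bound on the sphere extends to
      every nonzero \<open>x\<close> by normalising.\<close>
    have "m \<le> (x /\<^sub>R norm x) \<bullet> (S *v (x /\<^sub>R norm x))"
      unfolding m_def using False by (intro min) auto
    also have "\<dots> = (x \<bullet> (S *v x)) / (x \<bullet> x)"
      by (simp add: matrix_vector_mult_scaleR dot_square_norm power2_eq_square field_simps)
    finally show ?thesis
      using False by (simp add: field_simps)
  qed simp
  have shift: "(S - mat m) *v x = S *v x - m *s x" for x
  proof -
    have "mat m *v x = m *s x"
      by (simp add: vec_eq_iff matrix_vector_mult_def mat_def if_distribR sum.delta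
          if_distrib[of "\<lambda>z. z * _"] cong: if_cong)
    then show ?thesis
      by (simp add: matrix_vector_mult_diff_rdistrib)
  qed
  have "(S - mat m) *v v = 0"
  proof (rule quadratic_form_null_vector)
    show "transpose (S - mat m) = S - mat m"
      using sym by (auto simp: transpose_def mat_def vec_eq_iff)
    show "0 \<le> w \<bullet> ((S - mat m) *v w)" for w
      using le[of w] by (simp add: shift inner_diff_right scalar_mult_eq_scaleR)
    show "v \<bullet> ((S - mat m) *v v) = 0"
      using v by (simp add: shift inner_diff_right scalar_mult_eq_scaleR dot_square_norm
          flip: m_def)
  qed
  then have "complex_of_real m \<in> eigenvalues S"
    using v by (intro of_real_in_eigenvaluesI[of v]) (auto simp: shift)
  with le show thesis
    by (rule that[rotated])
qed

lemma inner_pos_if_eigenvalues_pos: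
  fixes A :: "real ^ 'n ^ 'n"
  assumes "eigenvalues (A + transpose A) \<subseteq> complex_of_real ` {0<..}" and "x \<noteq> 0"
  shows "x \<bullet> (A *v x) > 0"
proof -
  have "transpose (A + transpose A) = A + transpose A"
    by (simp add: transpose_def vec_eq_iff)
  then obtain m where "complex_of_real m \<in> eigenvalues (A + transpose A)"
    and le: "m * (x \<bullet> x) \<le> x \<bullet> ((A + transpose A) *v x)"
    by (rule symmetric_matrix_least_eigenvalue) blast
  then have "m > 0"
    using assms(1) by auto
  then have "0 < m * (x \<bullet> x)"
    using \<open>x \<noteq> 0\<close> by simp
  also note le
  \<comment> \<open>\<open>A\<close> and \<open>transpose A\<close> have the same quadratic form, so
    positivity passes from the symmetric sum to \<open>A\<close> itself.\<close>
  also have "x \<bullet> ((A + transpose A) *v x) = 2 * (x \<bullet> (A *v x))"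
    by (simp add: matrix_vector_mult_add_rdistrib inner_add_right inner_transpose_matrix_vector
        del: transpose_matrix_vector)
  finally show ?thesis
    by simp
qed

lemma matrix_vector_mult_uminus:
  fixes A :: "'a::ring_1 ^ 'n ^ 'm"
  shows "(- A) *v x = - (A *v x)"
  by (simp add: matrix_vector_mult_def vec_eq_iff sum_negf)

text \<open>A matrix and its negative share their eigenvectors, with eigenvalues of opposite sign.
  This reduces the negative definite case to the positive one, applied to
  \<open>- A\<close>.\<close>

lemma eigenvalues_uminus: "eigenvalues (- A) = uminus ` eigenvalues A"
proof -
  have uminus: "map_matrix complex_of_real (- A) = - map_matrix complex_of_real A"
    by (simp add: map_matrix_def vec_eq_iff)
  have "l \<in> eigenvalues (- A) \<longleftrightarrow> - l \<in> eigenvalues A" for l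
    unfolding eigenvalues_def mem_Collect_eq uminus matrix_vector_mult_uminus
    by (metis minus_equation_iff vector_sneg_minus1 vector_smult_assoc mult_minus1)
  then show ?thesis
    by (force simp: image_iff)
qed

lemma inner_neg_if_eigenvalues_neg:
  fixes A :: "real ^ 'n ^ 'n"
  assumes "eigenvalues (A + transpose A) \<subseteq> complex_of_real ` {..<0}" and "x \<noteq> 0"
  shows "x \<bullet> (A *v x) < 0"
proof -
  have eq: "- A + transpose (- A) = - (A + transpose A)"
    by (simp add: transpose_def vec_eq_iff)
  have "eigenvalues (- A + transpose (- A)) \<subseteq> complex_of_real ` {0<..}"
    unfolding eq eigenvalues_uminus using assms(1) by (force simp flip: of_real_minus)
  from inner_pos_if_eigenvalues_pos[OF this \<open>x \<noteq> 0\<close>] show ?thesis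
    by (simp add: matrix_vector_mult_uminus)
qed

text \<open>The mean value theorem holds with equality only for real-valued functions, so it is
  applied to the component of \<open>F\<close> along \<open>h = b - a\<close>, restricted to the
  segment from \<open>a\<close> to \<open>b\<close>. If \<open>F a = F b\<close>, this component has
  equal values at both ends, and the form vanishes at \<open>h\<close> for some intermediate
  Jacobian.\<close>

lemma inj_if_jacobian_quadratic_form_nonzero:
  fixes F :: "real ^ 'n \<Rightarrow> real ^ 'n"
  assumes diff: "\<And>x. F differentiable (at x)"
    and nz: "\<And>x h. h \<noteq> 0 \<Longrightarrow> h \<bullet> (jacobian F (at x) *v h) \<noteq> 0"
  shows "inj F"
proof (rule injI, rule ccontr)
  fix a b assume "F a = F b" "a \<noteq> b"
  define h where "h = b - a"
  have "((\<lambda>t. h \<bullet> F (a + t *\<^sub>R h)) has_derivative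
      (\<lambda>s. h \<bullet> (jacobian F (at (a + t *\<^sub>R h)) *v (s *\<^sub>R h)))) (at t)" for t
  proof -
    have "(F has_derivative (\<lambda>v. jacobian F (at (a + t *\<^sub>R h)) *v v)) (at (a + t *\<^sub>R h))"
      using diff jacobian_works by blast
    moreover have "((\<lambda>t. a + t *\<^sub>R h) has_derivative (\<lambda>s. s *\<^sub>R h)) (at t)"
      by (auto intro!: derivative_eq_intros)
    ultimately have "((\<lambda>t. F (a + t *\<^sub>R h)) has_derivative
        (\<lambda>s. jacobian F (at (a + t *\<^sub>R h)) *v (s *\<^sub>R h))) (at t)"
      by (rule has_derivative_compose[rotated])
    then show ?thesis
      by (rule has_derivative_inner_right)
  qed
  \<comment> \<open>The factors 1, 0 and \<open>1 - 0\<close> are left unsimplified so that the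
    statement unifies with \<open>mvt_simple\<close> on the interval from 0 to 1.\<close>
  then have "\<exists>t\<in>{0<..<1}. h \<bullet> F (a + 1 *\<^sub>R h) - h \<bullet> F (a + 0 *\<^sub>R h)
      = h \<bullet> (jacobian F (at (a + t *\<^sub>R h)) *v ((1 - 0) *\<^sub>R h))"
    by (intro mvt_simple) (auto intro: has_derivative_at_withinI)
  then obtain t where "h \<bullet> (jacobian F (at (a + t *\<^sub>R h)) *v h) = 0"
    using \<open>F a = F b\<close> by (auto simp: h_def)
  then show False
    using nz \<open>a \<noteq> b\<close> by (simp add: h_def)
qed

theorem theorem1p6:
  fixes F :: "real ^ 'n \<Rightarrow> real ^ 'n"
  assumes "CARD('n) \<ge> 2"
    and "C1_map F"
    and "0 \<notin> Spec F"
    and "\<exists>\<epsilon>>0. Spec_sym F \<subseteq> complex_of_real ` {..< -\<epsilon>} \<or>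
                Spec_sym F \<subseteq> complex_of_real ` {\<epsilon><..}"
  shows "inj F"
proof (rule inj_if_jacobian_quadratic_form_nonzero)
  show "F differentiable (at x)" for x
    using assms(2) by (simp add: C1_map_def)
  fix x h :: "real ^ 'n" assume "h \<noteq> 0"
  let ?J = "jacobian F (at x)"
  have "eigenvalues (?J + transpose ?J) \<subseteq> Spec_sym F"
    by (auto simp: Spec_sym_def)
  moreover obtain \<epsilon> :: real where "\<epsilon> > 0"
    and "Spec_sym F \<subseteq> complex_of_real ` {..< -\<epsilon>} \<or> Spec_sym F \<subseteq> complex_of_real ` {\<epsilon><..}"
    using assms(4) by blast
  \<comment> \<open>The rays are enlarged to open half-lines, the form in which the two definiteness
    lemmas take the spectrum at a single point.\<close>
  moreover have "{..< -\<epsilon>} \<subseteq> {..<0}" "{\<epsilon><..} \<subseteq> {0<..}"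
    using \<open>\<epsilon> > 0\<close> by auto
  ultimately have "eigenvalues (?J + transpose ?J) \<subseteq> complex_of_real ` {..<0} \<or>
      eigenvalues (?J + transpose ?J) \<subseteq> complex_of_real ` {0<..}"
    by (meson image_mono subset_trans)
  then show "h \<bullet> (?J *v h) \<noteq> 0"
    using inner_pos_if_eigenvalues_pos inner_neg_if_eigenvalues_neg \<open>h \<noteq> 0\<close>
    by (metis less_irrefl)
qed

end
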